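(* Let $\Gamma\subset \mathrm{PSL}(2,\mathbb{R})$ be a Fuchsian group. For $F\subset \mathbb{H}^2$, denote \[\mathcal{F}=\{g=b_x a_{\ln y}d_\theta\, :\, x+iy\in F,\ \theta\in [0,2\pi)\} \subset \mathrm{PSL}(2,\mathbb{R}).\] Then $F$ is a fundamental domain for $\Gamma$ in $\mathbb{H}^2$ if and only if $\mathcal{F}$ is a fundamental domain for $\Gamma$ in $\mathrm{PSL}(2,\mathbb{R})$.
   Context: $\mathbb{H}^2=\{z=x+iy\in\mathbb{C}: y>0\}$ is the hyperbolic upper half plane. $\mathrm{PSL}(2,\mathbb{R})=\mathrm{SL}(2,\mathbb{R})/\{\pm E_2\}$, where $E_2$ is the $2\times 2$ unit matrix, carries the quotient topology from $\mathrm{SL}(2,\mathbb{R})$; $[G]$ denotes the class of $G\in\mathrm{SL}(2,\mathbb{R})$, and $e$ denotes the unity of a group. A Fuchsian group is a discrete subgroup of $\mathrm{PSL}(2,\mathbb{R})$. For $t\in\mathbb{R}$, let $a_t=\left[\begin{pmatrix} e^{t/2}&0\\0&e^{-t/2}\end{pmatrix}\right]$, $b_t=\left[\begin{pmatrix}1&t\\0&1\end{pmatrix}\right]$, $d_t=\left[\begin{pmatrix}\cos\frac t2&\sin\frac t2\\-\sin\frac t2&\cos\frac t2\end{pmatrix}\right]$ in $\mathrm{PSL}(2,\mathbb{R})$. Fundamental domain: if a group $G$ acts on a topological space $X$ by a (left) action $\rho:G\times X\to X$, a non-empty open set $F\subset X$ is a fundamental domain for $G$ (in $X$) if (a) $\bigcup_{g\in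 G}\rho(g,\overline{F})=X$, where $\overline F$ is the closure of $F$ in $X$ and $\rho(g,A)=\{\rho(g,x):x\in A\}$, and (b) $\rho(g,F)\cap F=\varnothing$ for all $g\in G\setminus\{e\}$. A Fuchsian group $\Gamma$ acts on $\mathbb{H}^2$ by Möbius transformations, $\left[\begin{pmatrix}a&b\\c&d\end{pmatrix}\right]$ acting by $z\mapsto\frac{az+b}{cz+d}$, and acts on $\mathrm{PSL}(2,\mathbb{R})$ by left multiplication $(\gamma,g)\mapsto\gamma g$. Fundamental domains in $\mathbb{H}^2$ and in $\mathrm{PSL}(2,\mathbb{R})$ are meant with respect to these actions. *)

theory Defs
  imports "HOL-Analysis.Analysis" "HOL-Algebra.Group_Action"
begin

abbreviation mat22 :: "real \<Rightarrow> real \<Rightarrow> real \<Rightarrow> real \<Rightarrow> real^2^2"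
  where "mat22 a b c d \<equiv> vector [vector [a, b], vector [c, d]]"

definition SL2 :: "(real^2^2) monoid"
  where "SL2 = \<lparr>carrier = {A. det A = 1}, mult = (**), one = mat 1\<rparr>"

definition PSL2 :: "(real^2^2) set monoid"
  where "PSL2 = SL2 Mod {mat 1, - mat 1}"

text \<open>The class \<open>[A]\<close> is the coset \<open>{A, - A}\<close>, see \<open>psl_class_eq\<close>.\<close>

definition psl_class :: "real^2^2 \<Rightarrow> (real^2^2) set"
  where "psl_class A = {mat 1, - mat 1} #>\<^bsub>SL2\<^esub> A"

text \<open>Carried by the image of \<open>f\<close>; that this is a topology making \<open>f\<close> a quotient map is
  \<open>quotient_map_quotient_topology\<close>.\<close>

definition quotient_topology :: "'a topology \<Rightarrow> ('a \<Rightarrow> 'b) \<Rightarrow> 'b topology"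
  where "quotient_topology X f =
    topology (\<lambda>U. U \<subseteq> f ` topspace X \<and> openin X {x \<in> topspace X. f x \<in> U})"

definition PSL2_topology :: "(real^2^2) set topology"
  where "PSL2_topology = quotient_topology (top_of_set (carrier SL2)) psl_class"

definition fuchsian_group :: "(real^2^2) set set \<Rightarrow> bool"
  where "fuchsian_group \<Gamma> \<longleftrightarrow>
    subgroup \<Gamma> PSL2 \<and> subtopology PSL2_topology \<Gamma> = discrete_topology \<Gamma>"

definition psl_a :: "real \<Rightarrow> (real^2^2) set"
  where "psl_a t = psl_class (mat22 (exp (t/2)) 0 0 (exp (- t/2)))"

definition psl_b :: "real \<Rightarrow> (real^2^2) set"
  where "psl_b t = psl_class (mat22 1 t 0 1)"

definition psl_d :: "real \<Rightarrow> (real^2^2) set"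
  where "psl_d t = psl_class (mat22 (cos (t/2)) (sin (t/2)) (- sin (t/2)) (cos (t/2)))"

definition upper_half_plane :: "complex set"
  where "upper_half_plane = {z. Im z > 0}"

definition moebius_mat :: "real^2^2 \<Rightarrow> complex \<Rightarrow> complex"
  where "moebius_mat A = moebius (complex_of_real (A$1$1)) (complex_of_real (A$1$2))
    (complex_of_real (A$2$1)) (complex_of_real (A$2$2))"

text \<open>Library actions (\<open>group_action\<close>) take values in extensional functions, hence the
  restrictions below. The choice of a representative is immaterial, see
  \<open>moebius_action_psl_class\<close>.\<close>

definition moebius_action :: "(real^2^2) set \<Rightarrow> complex \<Rightarrow> complex"
  where "moebius_action g = (\<lambda>z\<in>upper_half_plane. moebius_mat (SOME A. A \<in> g) z)"

definition left_mult_action :: "(real^2^2) set \<Rightarrow> (real^2^2) set \<Rightarrow> (real^2^2) set"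
  where "left_mult_action g = (\<lambda>h\<in>carrier PSL2. g \<otimes>\<^bsub>PSL2\<^esub> h)"

text \<open>Meant for \<open>group_action G (topspace X) \<rho>\<close>; for the two actions above this is proved in
  \<open>group_action_moebius_action\<close> and \<open>group_action_left_mult_action\<close>. The closure constant is
  qualified because HOL-Algebra has another one of the same name.\<close>

definition fundamental_domain ::
    "('g, 'm) monoid_scheme \<Rightarrow> 'x topology \<Rightarrow> ('g \<Rightarrow> 'x \<Rightarrow> 'x) \<Rightarrow> 'x set \<Rightarrow> bool"
  where "fundamental_domain G X \<rho> F \<longleftrightarrow>
    F \<noteq> {} \<and> openin X F \<and>
    (\<Union>g\<in>carrier G. \<rho> g ` Abstract_Topology.closure_of X F) = topspace X \<and>
    (\<forall>g\<in>carrier G - {\<one>\<^bsub>G\<^esub>}. \<rho> g ` F \<inter> F = {})"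

lemma quotient_map_quotient_topology:
  "quotient_map X (quotient_topology X f) f"
proof -
  let ?P = "\<lambda>U. U \<subseteq> f ` topspace X \<and> openin X {x \<in> topspace X. f x \<in> U}"
  have "istopology ?P"
    unfolding istopology_def
  proof (intro conjI allI impI)
    fix S T assume S: "?P S" and T: "?P T"
    have "{x \<in> topspace X. f x \<in> S \<inter> T} =
        {x \<in> topspace X. f x \<in> S} \<inter> {x \<in> topspace X. f x \<in> T}" by auto
    then show "openin X {x \<in> topspace X. f x \<in> S \<inter> T}"
      using S T by (simp only: openin_Int)
  next
    fix S T assume "?P S" "?P T"
    then show "S \<inter> T \<subseteq> f ` topspace X" by auto
  next
    fix \<K> assume "\<forall>K\<in>\<K>. ?P K"
    then show "\<Union>\<K> \<subseteq> f ` topspace X" by auto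
  next
    fix \<K> assume K: "\<forall>K\<in>\<K>. ?P K"
    have "{x \<in> topspace X. f x \<in> \<Union>\<K>} = (\<Union>K\<in>\<K>. {x \<in> topspace X. f x \<in> K})" by auto
    then show "openin X {x \<in> topspace X. f x \<in> \<Union>\<K>}"
      using K by auto
  qed
  then have o: "openin (quotient_topology X f) U \<longleftrightarrow> ?P U" for U
    by (simp add: quotient_topology_def topology_inverse')
  have "?P (f ` topspace X)"
  proof -
    have "{x \<in> topspace X. f x \<in> f ` topspace X} = topspace X" by auto
    then show ?thesis by simp
  qed
  then have "topspace (quotient_topology X f) = f ` topspace X"
    by (intro subset_antisym) (metis o openin_topspace, metis o openin_subset)
  then show ?thesis
    unfolding quotient_map_def using o by auto
qed

lemma group_SL2: "group SL2"
proof (rule groupI)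
  fix A assume "A \<in> carrier SL2"
  then have d: "det A = 1" by (simp add: SL2_def)
  then obtain B where B: "B ** A = mat 1"
    using invertible_det_nz[of A] by (auto simp: invertible_def)
  then have "det B * det A = 1" by (metis det_I det_mul)
  with d B show "\<exists>B\<in>carrier SL2. B \<otimes>\<^bsub>SL2\<^esub> A = \<one>\<^bsub>SL2\<^esub>"
    by (auto simp: SL2_def)
qed (auto simp: SL2_def det_mul matrix_mul_assoc)

lemma matrix_mul_uminus22:
  fixes A B :: "real^2^2"
  shows "(- A) ** B = - (A ** B)" "A ** (- B) = - (A ** B)"
  by (simp_all add: matrix_matrix_mult_def vec_eq_iff sum_negf)

lemma det_uminus22: "det (- A) = det (A :: real^2^2)"
  by (simp add: det_2)

lemma psl_class_eq: "psl_class A = {A, - A}"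
  by (auto simp: psl_class_def r_coset_def SL2_def matrix_mul_uminus22)

lemma normal_SL2: "{mat 1, - mat 1} \<lhd> SL2"
proof -
  interpret group SL2 by (rule group_SL2)
  have "subgroup {mat 1, - mat 1} SL2"
  proof (rule subgroupI)
    fix A :: "real^2^2" assume A: "A \<in> {mat 1, - mat 1}"
    then have "A \<otimes>\<^bsub>SL2\<^esub> A = \<one>\<^bsub>SL2\<^esub>" "A \<in> carrier SL2"
      by (auto simp: SL2_def matrix_mul_uminus22 det_uminus22)
    then have "inv\<^bsub>SL2\<^esub> A = A" by (simp add: inv_equality)
    with A show "inv\<^bsub>SL2\<^esub> A \<in> {mat 1, - mat 1}" by simp
  qed (auto simp: SL2_def matrix_mul_uminus22 det_uminus22)
  moreover have "\<forall>x\<in>carrier SL2. {mat 1, - mat 1} #>\<^bsub>SL2\<^esub> x = x <#\<^bsub>SL2\<^esub> {mat 1, - mat 1}"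
    by (auto simp: r_coset_def l_coset_def SL2_def matrix_mul_uminus22)
  ultimately show ?thesis by (rule normalI)
qed

lemma group_PSL2: "group PSL2"
  unfolding PSL2_def by (rule normal.factorgroup_is_group[OF normal_SL2])

lemma carrier_PSL2: "carrier PSL2 = psl_class ` {A. det A = 1}"
  by (simp add: PSL2_def carrier_FactGroup psl_class_def[abs_def]) (simp add: SL2_def)

lemma one_PSL2: "\<one>\<^bsub>PSL2\<^esub> = psl_class (mat 1)"
  by (simp add: PSL2_def psl_class_eq)

lemma mult_PSL2:
  assumes "det A = 1" "det B = 1"
  shows "psl_class A \<otimes>\<^bsub>PSL2\<^esub> psl_class B = psl_class (A ** B)"
  using normal.rcos_sum[OF normal_SL2, of A B] assms
  by (simp add: PSL2_def psl_class_def) (simp add: SL2_def)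

lemma topspace_PSL2_topology: "topspace PSL2_topology = carrier PSL2"
proof -
  have "topspace PSL2_topology = psl_class ` topspace (top_of_set (carrier SL2))"
    unfolding PSL2_topology_def
    using quotient_imp_surjective_map[OF quotient_map_quotient_topology] by metis
  then show ?thesis by (simp add: carrier_PSL2) (simp add: SL2_def)
qed

lemma moebius_action_psl_class:
  assumes "z \<in> upper_half_plane"
  shows "moebius_action (psl_class A) z = moebius_mat A z"
proof -
  have "(SOME B. B \<in> psl_class A) \<in> psl_class A"
    by (rule someI[of _ A]) (simp add: psl_class_eq)
  then have "(SOME B. B \<in> psl_class A) = A \<or> (SOME B. B \<in> psl_class A) = - A"
    by (auto simp: psl_class_eq)
  moreover have "moebius_mat (- A) z = moebius_mat A z"
  proof -
    have "moebius_mat (- A) z = (- (complex_of_real (A$1$1) * z + complex_of_real (A$1$2))) /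
        (- (complex_of_real (A$2$1) * z + complex_of_real (A$2$2)))"
      unfolding moebius_mat_def moebius_def vector_uminus_component of_real_minus
        mult_minus_left minus_add_distrib ..
    also have "\<dots> = moebius_mat A z"
      unfolding moebius_mat_def moebius_def by (rule minus_divide_divide)
    finally show ?thesis .
  qed
  ultimately have "moebius_mat (SOME B. B \<in> psl_class A) z = moebius_mat A z"
    by metis
  then show ?thesis using assms unfolding moebius_action_def by simp
qed

lemma moebius_mat_denominator_nonzero:
  fixes A :: "real^2^2"
  assumes "det A = 1" "Im z > 0"
  shows "complex_of_real (A$2$1) * z + complex_of_real (A$2$2) \<noteq> 0"
proof
  assume "complex_of_real (A$2$1) * z + complex_of_real (A$2$2) = 0"
  then have "A$2$1 * Im z = 0" "A$2$1 * Re z + A$2$2 = 0"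
    by (auto simp: complex_eq_iff)
  with assms(2) have "A$2$1 = 0" "A$2$2 = 0" by auto
  then have "det A = 0" by (simp add: det_2)
  with assms(1) show False by simp
qed

lemma Im_moebius_mat:
  fixes A :: "real^2^2"
  assumes "det A = 1" "Im z > 0"
  shows "Im (moebius_mat A z) = Im z / (cmod (complex_of_real (A$2$1) * z + complex_of_real (A$2$2)))\<^sup>2"
proof -
  have "(A$1$1 * Im z) * (A$2$1 * Re z + A$2$2) - (A$1$1 * Re z + A$1$2) * (A$2$1 * Im z)
      = det A * Im z"
    by (simp add: det_2 algebra_simps)
  then show ?thesis
    using assms by (simp add: moebius_mat_def moebius_def Im_divide cmod_power2)
qed

lemma moebius_mat_in_upper_half_plane:
  fixes A :: "real^2^2"
  assumes "det A = 1" "z \<in> upper_half_plane"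
  shows "moebius_mat A z \<in> upper_half_plane"
  using assms Im_moebius_mat[of A z] moebius_mat_denominator_nonzero[of A z]
  by (simp add: upper_half_plane_def)

lemma moebius_mat_one: "moebius_mat (mat 1) z = z"
  by (simp add: moebius_mat_def moebius_def mat_def)

lemma moebius_mat_mult:
  fixes A B :: "real^2^2"
  assumes "det A = 1" "det B = 1" "z \<in> upper_half_plane"
  shows "moebius_mat (A ** B) z = moebius_mat A (moebius_mat B z)"
proof -
  define p q where "p = complex_of_real (B$1$1) * z + complex_of_real (B$1$2)"
    and "q = complex_of_real (B$2$1) * z + complex_of_real (B$2$2)"
  have q: "q \<noteq> 0"
    using moebius_mat_denominator_nonzero[of B z] assms by (simp add: q_def upper_half_plane_def)
  have "moebius_mat A (moebius_mat B z) = moebius_mat A (p / q)"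
    by (simp add: moebius_mat_def moebius_def p_def q_def)
  also have "\<dots> = (complex_of_real (A$1$1) * p + complex_of_real (A$1$2) * q) /
      (complex_of_real (A$2$1) * p + complex_of_real (A$2$2) * q)"
    using q mult_divide_mult_cancel_right[OF q, of "complex_of_real (A$1$1) * (p / q) + complex_of_real (A$1$2)"
      "complex_of_real (A$2$1) * (p / q) + complex_of_real (A$2$2)"]
    by (simp add: moebius_mat_def moebius_def distrib_right)
  also have "\<dots> = moebius_mat (A ** B) z"
    by (simp add: moebius_mat_def moebius_def p_def q_def matrix_matrix_mult_def sum_2 algebra_simps)
  finally show ?thesis by simp
qed

lemma group_actionI:
  assumes G: "group G"
    and closed: "\<And>g x. g \<in> carrier G \<Longrightarrow> x \<in> E \<Longrightarrow> \<rho> g x \<in> E"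
    and ext: "\<And>g. g \<in> carrier G \<Longrightarrow> \<rho> g \<in> extensional E"
    and one: "\<And>x. x \<in> E \<Longrightarrow> \<rho> \<one>\<^bsub>G\<^esub> x = x"
    and mult: "\<And>g h x. g \<in> carrier G \<Longrightarrow> h \<in> carrier G \<Longrightarrow> x \<in> E \<Longrightarrow>
      \<rho> (g \<otimes>\<^bsub>G\<^esub> h) x = \<rho> g (\<rho> h x)"
  shows "group_action G E \<rho>"
proof -
  interpret group G by (rule G)
  have Bij: "\<rho> g \<in> Bij E" if g: "g \<in> carrier G" for g
  proof -
    have "bij_betw (\<rho> g) E E"
    proof (rule bij_betwI[where g = "\<rho> (inv\<^bsub>G\<^esub> g)"])
      show "\<rho> g \<in> E \<rightarrow> E" "\<rho> (inv\<^bsub>G\<^esub> g) \<in> E \<rightarrow> E" using closed g by auto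
      show "\<rho> (inv\<^bsub>G\<^esub> g) (\<rho> g x) = x" if "x \<in> E" for x
        using mult[of "inv\<^bsub>G\<^esub> g" g x] one that g by simp
      show "\<rho> g (\<rho> (inv\<^bsub>G\<^esub> g) x) = x" if "x \<in> E" for x
        using mult[of g "inv\<^bsub>G\<^esub> g" x] one that g by simp
    qed
    then show ?thesis using ext g by (simp add: Bij_def)
  qed
  have "\<rho> (g \<otimes>\<^bsub>G\<^esub> h) = compose E (\<rho> g) (\<rho> h)" if "g \<in> carrier G" "h \<in> carrier G" for g h
    by (rule extensionalityI[of _ E]) (use that ext mult in \<open>auto simp: compose_eq\<close>)
  then have "\<rho> \<in> hom G (BijGroup E)"
    using Bij by (auto simp: hom_def BijGroup_def)
  then show ?thesis
    unfolding group_action_def group_hom_def group_hom_axioms_def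
    using G group_BijGroup by blast
qed

lemma group_action_moebius_action:
  assumes "subgroup \<Gamma> PSL2"
  shows "group_action (PSL2\<lparr>carrier := \<Gamma>\<rparr>) upper_half_plane moebius_action"
proof (rule group_actionI)
  interpret group PSL2 by (rule group_PSL2)
  show "group (PSL2\<lparr>carrier := \<Gamma>\<rparr>)" by (rule subgroup_imp_group[OF assms])
next
  have sub: "\<exists>A. det A = 1 \<and> g = psl_class A" if "g \<in> \<Gamma>" for g
    using that subgroup.subset[OF assms] by (auto simp: carrier_PSL2)
  fix g z assume g: "g \<in> carrier (PSL2\<lparr>carrier := \<Gamma>\<rparr>)" and z: "z \<in> upper_half_plane"
  then obtain A where A: "det A = 1" "g = psl_class A" using sub by auto
  with z show "moebius_action g z \<in> upper_half_plane"
    by (simp add: moebius_action_psl_class moebius_mat_in_upper_half_plane)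
  fix h assume "h \<in> carrier (PSL2\<lparr>carrier := \<Gamma>\<rparr>)"
  then obtain B where B: "det B = 1" "h = psl_class B" using sub by auto
  with A z show "moebius_action (g \<otimes>\<^bsub>PSL2\<lparr>carrier := \<Gamma>\<rparr>\<^esub> h) z =
      moebius_action g (moebius_action h z)"
    by (simp add: mult_PSL2 moebius_action_psl_class moebius_mat_in_upper_half_plane moebius_mat_mult)
next
  fix g show "moebius_action g \<in> extensional upper_half_plane"
    by (simp add: moebius_action_def)
next
  fix z assume z: "z \<in> upper_half_plane"
  then show "moebius_action \<one>\<^bsub>PSL2\<lparr>carrier := \<Gamma>\<rparr>\<^esub> z = z"
    using z by (simp add: one_PSL2 moebius_action_psl_class moebius_mat_one)
qed

lemma group_action_left_mult_action:
  assumes "subgroup \<Gamma> PSL2"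
  shows "group_action (PSL2\<lparr>carrier := \<Gamma>\<rparr>) (carrier PSL2) left_mult_action"
proof -
  interpret group PSL2 by (rule group_PSL2)
  interpret subgroup \<Gamma> PSL2 by (rule assms)
  show ?thesis
    by (rule group_actionI)
      (auto simp: left_mult_action_def subgroup_imp_group[OF assms] m_assoc)
qed

end

theory Submission
  imports Defs
begin

text \<open>The orbit map \<open>g \<mapsto> g \<cdot> \<i>\<close> from \<open>PSL(2,\<real>)\<close> to the upper half plane is continuous, surjective and
  equivariant, and it is open because it has continuous local sections through every point. By the
  Iwasawa decomposition the set in question is the preimage of \<open>F\<close> under it, and both conditions of
  a fundamental domain are reflected by taking preimages under such a map, since preimages under
  open continuous maps commute with closures.\<close>

section \<open>Fundamental domains and preimages under open continuous maps\<close>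

lemma closure_of_open_continuous_preimage:
  assumes "open_map X Y p" "continuous_map X Y p" "S \<subseteq> topspace Y"
  shows "X closure_of {x \<in> topspace X. p x \<in> S} = {x \<in> topspace X. p x \<in> Y closure_of S}"
    (is "X closure_of ?P = ?Q")
proof
  have "closedin X ?Q"
    by (rule closedin_continuous_map_preimage[OF assms(2) closedin_closure_of])
  moreover have "?P \<subseteq> ?Q"
    using closure_of_subset[OF assms(3)] by blast
  ultimately show "X closure_of ?P \<subseteq> ?Q"
    by (intro closure_of_minimal)
next
  show "?Q \<subseteq> X closure_of ?P"
  proof
    fix x assume x: "x \<in> ?Q"
    have "\<exists>y. y \<in> ?P \<and> y \<in> U" if "x \<in> U" "openin X U" for U
    proof -
      have "openin Y (p ` U)" "p x \<in> p ` U"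
        using that assms(1) unfolding open_map_def by blast+
      moreover have "p x \<in> Y closure_of S" using x by blast
      ultimately obtain s where "s \<in> S" "s \<in> p ` U"
        unfolding in_closure_of by blast
      then show ?thesis using openin_subset[OF that(2)] by blast
    qed
    then show "x \<in> X closure_of ?P"
      using x unfolding in_closure_of by blast
  qed
qed

text \<open>Surjectivity of \<open>p\<close> makes taking preimages injective on subsets of
  \<open>topspace Y\<close>. Preimages also commute with unions, intersections, closures and, by
  equivariance, with the group elements, so each clause of the definition can be tested in either
  space.\<close>

lemma fundamental_domain_preimage_iff:
  assumes act: "group_action G (topspace X) \<rho>" "group_action G (topspace Y) \<sigma>"
    and p: "open_map X Y p" "continuous_map X Y p" "p ` topspace X = topspace Y"
    and equiv: "\<And>g x. g \<in> carrier G \<Longrightarrow> x \<in> topspace X \<Longrightarrow> p (\<rho> g x) = \<sigma> g (p x)"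
    and F: "F \<subseteq> topspace Y"
  shows "fundamental_domain G Y \<sigma> F \<longleftrightarrow>
    fundamental_domain G X \<rho> {x \<in> topspace X. p x \<in> F}"
proof -
  interpret \<rho>: group_action G "topspace X" \<rho> by (rule act)
  interpret \<sigma>: group_action G "topspace Y" \<sigma> by (rule act)
  let ?pre = "\<lambda>S. {x \<in> topspace X. p x \<in> S}"
  have p_pre: "p ` ?pre S = S" if "S \<subseteq> topspace Y" for S
  proof -
    have "p ` ?pre S = p ` topspace X \<inter> S" by blast
    then show ?thesis using p(3) that by blast
  qed
  have pre_inj: "S = T \<longleftrightarrow> ?pre S = ?pre T" if "S \<subseteq> topspace Y" "T \<subseteq> topspace Y" for S T
  proof
    assume "?pre S = ?pre T"
    then have "p ` ?pre S = p ` ?pre T" by (rule arg_cong)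
    then show "S = T" unfolding p_pre[OF that(1)] p_pre[OF that(2)] .
  qed (rule arg_cong)
  have act_pre: "\<rho> g ` ?pre S = ?pre (\<sigma> g ` S)" if g: "g \<in> carrier G" and S: "S \<subseteq> topspace Y" for g S
  proof
    show "\<rho> g ` ?pre S \<subseteq> ?pre (\<sigma> g ` S)"
    proof
      fix x assume "x \<in> \<rho> g ` ?pre S"
      then obtain x' where "x = \<rho> g x'" "x' \<in> topspace X" "p x' \<in> S" by blast
      then show "x \<in> ?pre (\<sigma> g ` S)"
        using \<rho>.element_image[OF g] equiv[OF g] by blast
    qed
    \<comment> \<open>Equivariance alone gives only the inclusion above. Here
      \<open>\<rho> g\<close> must be surjective, to write \<open>x\<close> as
      \<open>\<rho> g x'\<close>, and \<open>\<sigma> g\<close> injective, to conclude that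
      \<open>p x'\<close> is the given point \<open>s\<close> of \<open>S\<close>.\<close>
    show "?pre (\<sigma> g ` S) \<subseteq> \<rho> g ` ?pre S"
    proof
      fix x assume "x \<in> ?pre (\<sigma> g ` S)"
      then obtain s where x: "x \<in> topspace X" "p x = \<sigma> g s" and s: "s \<in> S" by blast
      obtain x' where x': "x' \<in> topspace X" "\<rho> g x' = x"
        using \<rho>.surj_prop[OF g] x(1) by (metis imageE)
      have "\<sigma> g (p x') = \<sigma> g s"
        using equiv[OF g x'(1)] unfolding x'(2) x(2) by (rule sym)
      moreover have "p x' \<in> topspace Y" "s \<in> topspace Y"
        using x'(1) p(3) s S by blast+
      ultimately have "p x' = s"
        by (rule inj_onD[OF \<sigma>.inj_prop[OF g]])
      with x' s show "x \<in> \<rho> g ` ?pre S" by blast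
    qed
  qed
  have act_sub: "\<sigma> g ` S \<subseteq> topspace Y" if "g \<in> carrier G" "S \<subseteq> topspace Y" for g S
    using \<sigma>.element_image[OF that(1)] that(2) by blast
  have nonempty: "F \<noteq> {} \<longleftrightarrow> ?pre F \<noteq> {}"
    using pre_inj[OF F, of "{}"] by blast
  have opens: "openin Y F \<longleftrightarrow> openin X (?pre F)"
  proof
    show "openin X (?pre F)" if "openin Y F"
      by (rule openin_continuous_map_preimage[OF p(2) that])
    assume "openin X (?pre F)"
    then have "openin Y (p ` ?pre F)"
      using p(1) unfolding open_map_def by blast
    then show "openin Y F" unfolding p_pre[OF F] .
  qed
  let ?C = "Y closure_of F"
  have C: "?C \<subseteq> topspace Y" by (rule closure_of_subset_topspace)
  \<comment> \<open>The covering condition is pulled back to \<open>X\<close>: the preimage passes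
    through the union, then through each \<open>\<sigma> g\<close>, and finally through the
    closure.\<close>
  have "(\<Union>g\<in>carrier G. \<sigma> g ` ?C) = topspace Y \<longleftrightarrow>
      ?pre (\<Union>g\<in>carrier G. \<sigma> g ` ?C) = ?pre (topspace Y)"
    by (rule pre_inj) (use act_sub C in blast)+
  also have "?pre (\<Union>g\<in>carrier G. \<sigma> g ` ?C) = (\<Union>g\<in>carrier G. ?pre (\<sigma> g ` ?C))"
    by blast
  also have "\<dots> = (\<Union>g\<in>carrier G. \<rho> g ` (X closure_of ?pre F))"
    unfolding closure_of_open_continuous_preimage[OF p(1,2) F]
    by (rule SUP_cong[OF refl]) (rule act_pre[OF _ C, symmetric])
  also have "?pre (topspace Y) = topspace X"
    using p(3) by blast
  finally have cover: "(\<Union>g\<in>carrier G. \<sigma> g ` ?C) = topspace Y \<longleftrightarrow>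
    (\<Union>g\<in>carrier G. \<rho> g ` (X closure_of ?pre F)) = topspace X" .
  have "\<sigma> g ` F \<inter> F = {} \<longleftrightarrow> \<rho> g ` ?pre F \<inter> ?pre F = {}" if "g \<in> carrier G" for g
  proof -
    have "\<rho> g ` ?pre F \<inter> ?pre F = ?pre (\<sigma> g ` F \<inter> F)"
      unfolding act_pre[OF that F] by blast
    moreover have "\<sigma> g ` F \<inter> F = {} \<longleftrightarrow> ?pre (\<sigma> g ` F \<inter> F) = ?pre {}"
      by (rule pre_inj) (use F in blast)+
    ultimately show ?thesis by simp
  qed
  then show ?thesis
    unfolding fundamental_domain_def nonempty opens cover by simp
qed

section \<open>Entries and continuity of matrices, and affine maps between points of the half
  plane\<close>

lemma mat22_nth [simp]:
  "mat22 a b c d $ 1 $ 1 = a" "mat22 a b c d $ 1 $ 2 = b"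
  "mat22 a b c d $ 2 $ 1 = c" "mat22 a b c d $ 2 $ 2 = d"
  by simp_all

lemma mat22_eq_iff:
  "A = mat22 a b c d \<longleftrightarrow> A$1$1 = a \<and> A$1$2 = b \<and> A$2$1 = c \<and> A$2$2 = d"
  by (auto simp: vec_eq_iff forall_2)

lemma mat22_mult:
  "mat22 a b c d ** mat22 a' b' c' d' =
    mat22 (a * a' + b * c') (a * b' + b * d') (c * a' + d * c') (c * b' + d * d')"
  by (simp add: mat22_eq_iff matrix_matrix_mult_def sum_2)

lemma mat_1_eq_mat22: "mat 1 = mat22 1 0 0 1"
  by (simp add: mat22_eq_iff mat_def)

lemma continuous_on_mat22 [continuous_intros]:
  assumes "continuous_on S a" "continuous_on S b" "continuous_on S c" "continuous_on S d"
  shows "continuous_on S (\<lambda>x. mat22 (a x) (b x) (c x) (d x))"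
proof -
  \<comment> \<open>Written with \<open>\<chi>\<close>, the matrix is continuous as soon as each
    entry is.\<close>
  have M: "mat22 a b c d =
      (\<chi> i j. if i = 1 then (if j = 1 then a else b) else (if j = 1 then c else d))" for a b c d
    by (simp add: vec_eq_iff forall_2)
  have "continuous_on S (\<lambda>x. if i = 1 then (if j = 1 then a x else b x)
      else (if j = 1 then c x else d x))" for i j :: 2
    using assms by (cases "i = 1"; cases "j = 1") simp_all
  then show ?thesis
    unfolding M by (intro continuous_on_vec_lambda)
qed

lemma continuous_on_matrix_mult_right:
  fixes B :: "real^'n^'m"
  assumes "continuous_on S A"
  shows "continuous_on S (\<lambda>x. (A x :: real^'m^'k) ** B)"
  unfolding matrix_matrix_mult_def
  by (intro continuous_on_vec_lambda continuous_intros assms)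

text \<open>The affine map \<open>u \<mapsto> (Im z / Im w) (u - Re w) + Re z\<close>, which sends \<open>w\<close> to \<open>z\<close>.\<close>

definition transport :: "complex \<Rightarrow> complex \<Rightarrow> real^2^2"
  where "transport w z = (let r = sqrt (Im z / Im w) in
    mat22 r ((Re z - r\<^sup>2 * Re w) / r) 0 (1 / r))"

context
  fixes w z :: complex
  assumes w: "w \<in> upper_half_plane" and z: "z \<in> upper_half_plane"
begin

lemma det_transport: "det (transport w z) = 1"
  using w z by (simp add: transport_def Let_def det_2 upper_half_plane_def)

lemma moebius_mat_transport: "moebius_mat (transport w z) w = z"
proof -
  define r where "r = sqrt (Im z / Im w)"
  have r: "r > 0" and "r * r = Im z / Im w"
    using w z by (simp_all add: r_def upper_half_plane_def)
  then have Im: "r * r * Im w = Im z"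
    using w by (simp add: upper_half_plane_def)
  \<comment> \<open>The lower row is \<open>0, 1 / r\<close>, so dividing by the denominator is
    multiplying by \<open>r\<close>.\<close>
  have "moebius_mat (transport w z) w =
      (of_real r * w + of_real ((Re z - r\<^sup>2 * Re w) / r)) * of_real r"
    unfolding moebius_mat_def moebius_def transport_def Let_def r_def[symmetric] mat22_nth
    by simp
  also have "\<dots> = z"
  proof (rule complex_eqI)
    show "Im ((of_real r * w + of_real ((Re z - r\<^sup>2 * Re w) / r)) * of_real r) = Im z"
      using Im by (simp add: mult_ac)
    have "(r * Re w + (Re z - r\<^sup>2 * Re w) / r) * r = Re z"
      using r unfolding distrib_right power2_eq_square by (simp add: mult_ac)
    then show "Re ((of_real r * w + of_real ((Re z - r\<^sup>2 * Re w) / r)) * of_real r) = Re z"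
      by simp
  qed
  finally show ?thesis .
qed

end

text \<open>This normalization lets the section built from \<open>transport\<close> pass through a
  prescribed matrix.\<close>

lemma transport_self: "w \<in> upper_half_plane \<Longrightarrow> transport w w = mat 1"
  by (simp add: transport_def mat_1_eq_mat22 upper_half_plane_def)

lemma continuous_on_transport:
  assumes "w \<in> upper_half_plane"
  shows "continuous_on upper_half_plane (transport w)"
  unfolding transport_def Let_def using assms
  by (intro continuous_intros) (auto simp: upper_half_plane_def)

section \<open>The orbit map on SL(2,R)\<close>

lemma continuous_on_moebius_mat:
  assumes "z \<in> upper_half_plane"
  shows "continuous_on (carrier SL2) (\<lambda>A. moebius_mat A z)"
  unfolding moebius_mat_def moebius_def
  by (intro continuous_intros)
    (use assms moebius_mat_denominator_nonzero in \<open>auto simp: SL2_def upper_half_plane_def\<close>)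

text \<open>Around the image \<open>v\<close> of any \<open>A\<close> in \<open>U\<close>, a
  continuous section of the orbit map through \<open>A\<close> suffices: the points that it sends
  into \<open>U\<close> form an open neighbourhood of \<open>v\<close>, and each of them is the
  image of its own section value.\<close>

lemma open_map_moebius_mat:
  assumes w: "w \<in> upper_half_plane"
  shows "open_map (top_of_set (carrier SL2)) (top_of_set upper_half_plane) (\<lambda>A. moebius_mat A w)"
  unfolding open_map_def
proof (intro allI impI)
  fix U assume U: "openin (top_of_set (carrier SL2)) U"
  then have USL: "U \<subseteq> carrier SL2" by (rule openin_imp_subset)
  show "openin (top_of_set upper_half_plane) ((\<lambda>A. moebius_mat A w) ` U)"
  proof (subst openin_subopen, intro ballI)
    fix v assume "v \<in> (\<lambda>A. moebius_mat A w) ` U"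
    then obtain A where A: "A \<in> U" and v: "v = moebius_mat A w" by auto
    have detA: "det A = 1" using A USL by (auto simp: SL2_def)
    have vH: "v \<in> upper_half_plane"
      using v detA w moebius_mat_in_upper_half_plane by simp
    \<comment> \<open>The section is defined on the whole half plane: \<open>A\<close> moves
      \<open>w\<close> to \<open>v\<close>, and \<open>transport v z\<close> moves \<open>v\<close>
      on to \<open>z\<close>. At \<open>z = v\<close> its value is \<open>A\<close>.\<close>
    let ?s = "\<lambda>z. transport v z ** A"
    have "continuous_on upper_half_plane ?s"
      by (intro continuous_on_matrix_mult_right continuous_on_transport vH)
    moreover have "?s \<in> upper_half_plane \<rightarrow> carrier SL2"
      using vH detA by (auto simp: SL2_def det_mul det_transport)
    ultimately have "openin (top_of_set upper_half_plane) (upper_half_plane \<inter> ?s -` U)"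
      using U continuous_on_open_gen by blast
    moreover have "v \<in> upper_half_plane \<inter> ?s -` U"
      using A vH by (simp add: transport_self)
    moreover have "upper_half_plane \<inter> ?s -` U \<subseteq> (\<lambda>A. moebius_mat A w) ` U"
    proof
      fix z assume z: "z \<in> upper_half_plane \<inter> ?s -` U"
      then have "moebius_mat (?s z) w = z"
        using vH detA w
        by (simp add: moebius_mat_mult det_transport moebius_mat_transport flip: v)
      then show "z \<in> (\<lambda>A. moebius_mat A w) ` U"
        using z by (intro image_eqI[of _ _ "?s z"]) simp_all
    qed
    ultimately show "\<exists>T. openin (top_of_set upper_half_plane) T \<and> v \<in> T \<and>
        T \<subseteq> (\<lambda>A. moebius_mat A w) ` U" by blast
  qed
qed

text \<open>Transitivity of the action, witnessed by \<open>transport w z\<close>.\<close>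

lemma moebius_action_image:
  assumes "w \<in> upper_half_plane"
  shows "(\<lambda>g. moebius_action g w) ` carrier PSL2 = upper_half_plane"
proof -
  have "z \<in> (\<lambda>A. moebius_mat A w) ` {A. det A = 1}" if "z \<in> upper_half_plane" for z
    using assms that by (intro image_eqI[of _ _ "transport w z"])
      (simp_all add: moebius_mat_transport det_transport)
  then show ?thesis
    using assms
    by (auto simp: carrier_PSL2 image_image moebius_action_psl_class moebius_mat_in_upper_half_plane)
qed

section \<open>Descent of the orbit map to PSL(2,R)\<close>

lemma quotient_map_psl_class:
  "quotient_map (top_of_set (carrier SL2)) PSL2_topology psl_class"
  unfolding PSL2_topology_def by (rule quotient_map_quotient_topology)

text \<open>Continuity on a quotient may be checked after composing with the quotient map, which
  leads back to matrices.\<close>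

lemma continuous_map_moebius_action:
  assumes w: "w \<in> upper_half_plane"
  shows "continuous_map PSL2_topology (top_of_set upper_half_plane) (\<lambda>g. moebius_action g w)"
  by (rule continuous_compose_quotient_map[OF quotient_map_psl_class])
    (use w continuous_on_moebius_mat[OF w] in
      \<open>auto simp: o_def moebius_action_psl_class SL2_def moebius_mat_in_upper_half_plane\<close>)

lemma open_map_moebius_action:
  assumes w: "w \<in> upper_half_plane"
  shows "open_map PSL2_topology (top_of_set upper_half_plane) (\<lambda>g. moebius_action g w)"
proof -
  let ?X = "top_of_set (carrier SL2)"
  have "openin (top_of_set upper_half_plane) ((\<lambda>g. moebius_action g w) ` U)"
    if U: "openin PSL2_topology U" for U
  proof -
    \<comment> \<open>Since \<open>psl_class\<close> maps \<open>?V\<close> onto \<open>U\<close>,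
      both sets have the same image in the half plane, and openness on matrices applies to
      \<open>?V\<close>.\<close>
    let ?V = "{A \<in> topspace ?X. psl_class A \<in> U}"
    have "openin ?X ?V"
      using openin_continuous_map_preimage[OF quotient_imp_continuous_map[OF quotient_map_psl_class] U] .
    then have "openin (top_of_set upper_half_plane) ((\<lambda>A. moebius_mat A w) ` ?V)"
      using open_map_moebius_mat[OF w] unfolding open_map_def by blast
    also have "(\<lambda>A. moebius_mat A w) ` ?V = (\<lambda>g. moebius_action g w) ` psl_class ` ?V"
      using w by (simp add: image_image moebius_action_psl_class)
    also have "psl_class ` ?V = U"
      using openin_subset[OF U] by (auto simp: topspace_PSL2_topology carrier_PSL2 SL2_def)
    finally show ?thesis .
  qed
  then show ?thesis unfolding open_map_def by blast
qed

section \<open>The stabilizer of i and the Iwasawa decomposition\<close>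

lemma i_in_upper_half_plane: "\<i> \<in> upper_half_plane"
  by (simp add: upper_half_plane_def)

lemma psl_class_uminus: "psl_class (- A) = psl_class A"
  by (auto simp: psl_class_eq)

text \<open>Clearing the denominator in the fixed point equation and comparing real and imaginary
  parts gives equal diagonal and opposite off-diagonal entries; determinant 1 then puts the first
  row on the unit circle, so the matrix is a rotation.\<close>

lemma moebius_mat_stabilizer_i:
  assumes det: "det A = 1" and fixed: "moebius_mat A \<i> = \<i>"
  shows "\<exists>\<theta>\<in>{0..<2*pi}. psl_class A = psl_d \<theta>"
proof -
  have "complex_of_real (A$1$1) * \<i> + complex_of_real (A$1$2) =
      \<i> * (complex_of_real (A$2$1) * \<i> + complex_of_real (A$2$2))"
    using fixed moebius_mat_denominator_nonzero[OF det, of \<i>]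
    by (simp add: moebius_mat_def moebius_def divide_eq_eq)
  then have ad: "A$1$1 = A$2$2" and bc: "A$1$2 = - A$2$1"
    by (auto simp: complex_eq_iff)
  have sq: "(A$1$1)\<^sup>2 + (A$1$2)\<^sup>2 = 1"
    using det ad bc by (simp add: det_2 power2_eq_square)
  \<comment> \<open>The sign of the representative is chosen so that the sine entry is nonnegative.
    The angle \<open>t\<close> then lies between 0 and \<open>pi\<close>, and the parameter
    \<open>2 * t\<close> of \<open>psl_d\<close> between 0 and \<open>2 * pi\<close>.\<close>
  define B where "B = (if A$1$2 \<ge> 0 then A else - A)"
  have B: "psl_class A = psl_class B" "B$1$1 = B$2$2" "B$1$2 = - B$2$1" "0 \<le> B$1$2"
    "(B$1$1)\<^sup>2 + (B$1$2)\<^sup>2 = 1"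
    using ad bc sq by (auto simp: B_def psl_class_uminus)
  obtain t where t: "0 \<le> t" "t \<le> pi" "B$1$1 = cos t" "B$1$2 = sin t"
    using sincos_total_pi[OF B(4,5)] by auto
  have Bt: "B = mat22 (cos t) (sin t) (- sin t) (cos t)"
    using B t by (simp add: mat22_eq_iff)
  show ?thesis
  proof (cases "t = pi")
    \<comment> \<open>Here \<open>2 * t\<close> would be the excluded endpoint
      \<open>2 * pi\<close>; but \<open>B\<close> is minus the identity, whose class is
      \<open>psl_d 0\<close>.\<close>
    case True
    then have "B = - mat22 1 0 0 1"
      using Bt by (simp add: vec_eq_iff forall_2)
    then have "psl_class A = psl_d 0"
      using B(1) by (simp add: psl_d_def psl_class_uminus)
    then show ?thesis by (intro bexI[of _ 0]) auto
  next
    case False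
    then have "psl_class A = psl_d (2 * t)"
      using B(1) Bt by (simp add: psl_d_def)
    then show ?thesis using False t by (intro bexI[of _ "2 * t"]) auto
  qed
qed

text \<open>Both sides represent the affine map that scales by \<open>y\<close> and then translates
  by \<open>x\<close>; in \<open>transport\<close> the scaling root is \<open>sqrt y\<close>, which
  equals \<open>exp (ln y / 2)\<close>.\<close>

lemma psl_b_mult_psl_a:
  assumes "y > 0"
  shows "psl_b x \<otimes>\<^bsub>PSL2\<^esub> psl_a (ln y) = psl_class (transport \<i> (Complex x y))"
proof -
  have "exp (ln y / 2) = sqrt y"
    using assms by (simp flip: ln_sqrt)
  then have "psl_a (ln y) = psl_class (mat22 (sqrt y) 0 0 (1 / sqrt y))"
    by (simp add: psl_a_def exp_minus inverse_eq_divide)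
  then show ?thesis
    using assms by (simp add: psl_b_def mult_PSL2 det_2 mat22_mult transport_def Let_def)
qed

lemma moebius_action_mult:
  assumes "g \<in> carrier PSL2" "h \<in> carrier PSL2" "w \<in> upper_half_plane"
  shows "moebius_action (g \<otimes>\<^bsub>PSL2\<^esub> h) w = moebius_action g (moebius_action h w)"
  using assms
  by (auto simp: carrier_PSL2 mult_PSL2 moebius_action_psl_class moebius_mat_mult
      moebius_mat_in_upper_half_plane)

lemma psl_d_in_PSL2: "psl_d \<theta> \<in> carrier PSL2"
  unfolding psl_d_def carrier_PSL2
  by (rule imageI) (simp add: det_2 flip: power2_eq_square)

lemma moebius_action_psl_d: "moebius_action (psl_d \<theta>) \<i> = \<i>"
proof -
  let ?A = "mat22 (cos (\<theta>/2)) (sin (\<theta>/2)) (- sin (\<theta>/2)) (cos (\<theta>/2))"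
  have "det ?A = 1" by (simp add: det_2 flip: power2_eq_square)
  from moebius_mat_denominator_nonzero[OF this, of \<i>] show ?thesis
    unfolding psl_d_def moebius_action_psl_class[OF i_in_upper_half_plane]
    by (simp add: moebius_mat_def moebius_def divide_eq_eq) (simp add: algebra_simps)
qed

text \<open>The rotation \<open>psl_d \<theta>\<close> fixes i and the two other factors move i to
  \<open>Complex x y\<close>, so every product lies in the preimage. Conversely, \<open>g\<close>
  differs from the affine element sending i to the same point by an element of the stabilizer of
  i.\<close>

lemma iwasawa_set_eq_preimage:
  assumes F: "F \<subseteq> upper_half_plane"
  shows "{psl_b x \<otimes>\<^bsub>PSL2\<^esub> psl_a (ln y) \<otimes>\<^bsub>PSL2\<^esub> psl_d \<theta> | x y \<theta>.
      Complex x y \<in> F \<and> \<theta> \<in> {0..<2*pi}} = {g \<in> carrier PSL2. moebius_action g \<i> \<in> F}"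
    (is "?L = ?R")
proof
  interpret group PSL2 by (rule group_PSL2)
  have T: "psl_class (transport \<i> z) \<in> carrier PSL2"
    "moebius_action (psl_class (transport \<i> z)) \<i> = z" if "z \<in> upper_half_plane" for z
    using that i_in_upper_half_plane
    by (auto simp: carrier_PSL2 moebius_action_psl_class det_transport moebius_mat_transport)
  show "?L \<subseteq> ?R"
  proof
    fix g assume "g \<in> ?L"
    then obtain x y \<theta> where xy: "Complex x y \<in> F"
      and g: "g = psl_b x \<otimes>\<^bsub>PSL2\<^esub> psl_a (ln y) \<otimes>\<^bsub>PSL2\<^esub> psl_d \<theta>" by blast
    let ?z = "Complex x y"
    have z: "?z \<in> upper_half_plane" using xy F by auto
    then have "g = psl_class (transport \<i> ?z) \<otimes>\<^bsub>PSL2\<^esub> psl_d \<theta>"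
      using g psl_b_mult_psl_a[of y x] by (simp add: upper_half_plane_def)
    then show "g \<in> ?R"
      using xy T[OF z]
      by (simp add: moebius_action_mult psl_d_in_PSL2 i_in_upper_half_plane moebius_action_psl_d)
  qed
  show "?R \<subseteq> ?L"
  proof
    fix g assume g: "g \<in> ?R"
    define z where "z = moebius_action g \<i>"
    have zF: "z \<in> F" and gC: "g \<in> carrier PSL2" using g by (auto simp: z_def)
    then have z: "z \<in> upper_half_plane" using F by auto
    let ?t = "psl_class (transport \<i> z)"
    \<comment> \<open>Both \<open>g\<close> and \<open>?t\<close> send i to \<open>z\<close>, so
      \<open>?h\<close> fixes i and is therefore some \<open>psl_d \<theta>\<close>.\<close>
    let ?h = "inv\<^bsub>PSL2\<^esub> ?t \<otimes>\<^bsub>PSL2\<^esub> g"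
    have h: "?h \<in> carrier PSL2" using gC T[OF z] by simp
    have "moebius_action ?h \<i> = moebius_action (inv\<^bsub>PSL2\<^esub> ?t) (moebius_action ?t \<i>)"
      using gC T[OF z] by (simp add: moebius_action_mult i_in_upper_half_plane flip: z_def)
    also have "\<dots> = moebius_action \<one>\<^bsub>PSL2\<^esub> \<i>"
      using T[OF z] moebius_action_mult[of "inv\<^bsub>PSL2\<^esub> ?t" ?t \<i>]
      by (simp add: i_in_upper_half_plane)
    also have "\<dots> = \<i>"
      by (simp add: one_PSL2 moebius_action_psl_class i_in_upper_half_plane moebius_mat_one)
    finally have "moebius_action ?h \<i> = \<i>" .
    moreover obtain A where A: "det A = 1" "?h = psl_class A"
      using h unfolding carrier_PSL2 by blast
    ultimately have "moebius_mat A \<i> = \<i>"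
      by (simp add: moebius_action_psl_class i_in_upper_half_plane)
    then obtain \<theta> where \<theta>: "\<theta> \<in> {0..<2*pi}" "?h = psl_d \<theta>"
      using moebius_mat_stabilizer_i[OF A(1)] A(2) by metis
    have "g = ?t \<otimes>\<^bsub>PSL2\<^esub> ?h"
      using gC T[OF z] m_assoc[of ?t "inv\<^bsub>PSL2\<^esub> ?t" g] by simp
    also have "\<dots> = psl_b (Re z) \<otimes>\<^bsub>PSL2\<^esub> psl_a (ln (Im z)) \<otimes>\<^bsub>PSL2\<^esub> psl_d \<theta>"
      using z \<theta>(2) psl_b_mult_psl_a[of "Im z" "Re z"] by (simp add: upper_half_plane_def)
    finally show "g \<in> ?L" using zF \<theta>(1)
      by (intro CollectI exI[of _ "Re z"] exI[of _ "Im z"] exI[of _ \<theta>]) simp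
  qed
qed

theorem theorem3p1:
  fixes \<Gamma> :: "(real^2^2) set set" and F :: "complex set"
  assumes "fuchsian_group \<Gamma>" and "F \<subseteq> upper_half_plane"
  shows "fundamental_domain (PSL2\<lparr>carrier := \<Gamma>\<rparr>) (top_of_set upper_half_plane) moebius_action F
    \<longleftrightarrow>
    fundamental_domain (PSL2\<lparr>carrier := \<Gamma>\<rparr>) PSL2_topology left_mult_action
      {psl_b x \<otimes>\<^bsub>PSL2\<^esub> psl_a (ln y) \<otimes>\<^bsub>PSL2\<^esub> psl_d \<theta> | x y \<theta>. Complex x y \<in> F \<and> \<theta> \<in> {0..<2*pi}}"
proof -
  have sub: "subgroup \<Gamma> PSL2"
    using assms(1) by (simp add: fuchsian_group_def)
  have equiv: "moebius_action (left_mult_action g h) \<i> = moebius_action g (moebius_action h \<i>)"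
    if "g \<in> \<Gamma>" "h \<in> carrier PSL2" for g h
    using that subgroup.subset[OF sub]
    by (auto simp: left_mult_action_def intro!: moebius_action_mult i_in_upper_half_plane)
  \<comment> \<open>The transfer result is applied to the orbit map of i; its equivariance is the
    compatibility of the action with products, since the group acts on PSL(2,R) from the
    left.\<close>
  show ?thesis
    unfolding iwasawa_set_eq_preimage[OF assms(2)] topspace_PSL2_topology[symmetric]
  proof (rule fundamental_domain_preimage_iff)
    show "group_action (PSL2\<lparr>carrier := \<Gamma>\<rparr>) (topspace PSL2_topology) left_mult_action"
      unfolding topspace_PSL2_topology by (rule group_action_left_mult_action[OF sub])
    show "group_action (PSL2\<lparr>carrier := \<Gamma>\<rparr>) (topspace (top_of_set upper_half_plane)) moebius_action"
      unfolding topspace_euclidean_subtopology by (rule group_action_moebius_action[OF sub])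
    show "(\<lambda>g. moebius_action g \<i>) ` topspace PSL2_topology = topspace (top_of_set upper_half_plane)"
      unfolding topspace_PSL2_topology topspace_euclidean_subtopology
      by (rule moebius_action_image[OF i_in_upper_half_plane])
    show "moebius_action (left_mult_action g h) \<i> = moebius_action g (moebius_action h \<i>)"
      if "g \<in> carrier (PSL2\<lparr>carrier := \<Gamma>\<rparr>)" "h \<in> topspace PSL2_topology" for g h
      using that by (simp add: equiv topspace_PSL2_topology)
    show "F \<subseteq> topspace (top_of_set upper_half_plane)"
      using assms(2) by simp
  qed (rule open_map_moebius_action continuous_map_moebius_action i_in_upper_half_plane)+
qed

end
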